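(* Let $C \subsetneq \mathbb{R}^d$ be a closed convex cone with $0 \in C$ and let $X \colon \Omega \to \mathbb{R}^d$ be a random variable. (a) If $w \in \mathbb{R}^d\setminus\{0\}$, then $Q^-_{X,w}(p) = \{z \in \mathbb{R}^d \mid w^Tz \geq q^-_{w^TX}(p)\}$ for all $p \in [0,1]$. (b) For all $p \in [0,1]$, \[ Q^-_{X,C}(p) = \bigcap_{w \in C^+\setminus\{0\}} \{z \in \mathbb{R}^d \mid w^Tz \geq q^-_{w^TX}(p)\}. \] (c) If $w \in C^+\setminus\{0\}$, then $q^-_{w^TX}(p) \leq \inf_{z \in Q^-_{X,C}(p)} w^Tz$ for all $p \in [0,1]$.
   Context: $(\Omega,\mathcal{F},P)$ is a probability space; random variables $\Omega \to \mathbb{R}^d$ are Borel measurable maps. A cone is a set $C \subseteq \mathbb{R}^d$ with $sz \in C$ for all $s>0$, $z \in C$. The dual cone is $C^+ = \{w \in \mathbb{R}^d \mid w^Tz \geq 0 \text{ for all } z \in C\}$. For $w \in \mathbb{R}^d\setminus\{0\}$, $F_{X,w}(z) = P(w^TX \leq w^Tz)$ and $Q^-_{X,w}(p) = \{z \in \mathbb{R}^d \mid F_{X,w}(z) \geq p\}$ (lower $w$-quantile). Moreover $F_{X,C}(z) = \inf_{w \in C^+\setminus\{0\}} F_{X,w}(z)$ and $Q^-_{X,C}(p) = \{z \in \mathbb{R}^d \mid F_{X,C}(z) \geq p\}$ (lower $C$-quantile), $p \in [0,1]$. The univariate lower quantile of $w^TX$ is $q^-_{w^TX}(p) = \inf\{s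 \in \mathbb{R} \mid P(w^TX \leq s) \geq p\}$, taken in the extended reals $\mathbb{R}\cup\{\pm\infty\}$, with $\inf \emptyset = +\infty$. *)

theory Defs
  imports "HOL-Probability.Probability"
begin

text \<open>Only positive scaling is required of a cone, unlike \<^const>\<open>cone\<close> of HOL-Analysis, where
  every nonempty cone contains 0.\<close>

definition positive_cone :: "(real ^ 'd) set \<Rightarrow> bool" where
  "positive_cone C \<longleftrightarrow> (\<forall>s>0. \<forall>z\<in>C. s *\<^sub>R z \<in> C)"

definition dual_cone :: "(real ^ 'd) set \<Rightarrow> (real ^ 'd) set" where
  "dual_cone C = {w. \<forall>z\<in>C. w \<bullet> z \<ge> 0}"

definition F_dir :: "'a measure \<Rightarrow> ('a \<Rightarrow> real ^ 'd) \<Rightarrow> real ^ 'd \<Rightarrow> real ^ 'd \<Rightarrow> real" where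
  "F_dir M X w z = measure M {\<omega> \<in> space M. w \<bullet> X \<omega> \<le> w \<bullet> z}"

definition Q_dir :: "'a measure \<Rightarrow> ('a \<Rightarrow> real ^ 'd) \<Rightarrow> real ^ 'd \<Rightarrow> real \<Rightarrow> (real ^ 'd) set" where
  "Q_dir M X w p = {z. F_dir M X w z \<ge> p}"

text \<open>The infimum below is taken in the reals. It is the true infimum whenever the dual cone contains
  a nonzero vector, which holds for every closed convex cone other than the whole space.\<close>

definition F_cone :: "'a measure \<Rightarrow> ('a \<Rightarrow> real ^ 'd) \<Rightarrow> (real ^ 'd) set \<Rightarrow> real ^ 'd \<Rightarrow> real" where
  "F_cone M X C z = (INF w \<in> dual_cone C - {0}. F_dir M X w z)"

definition Q_cone :: "'a measure \<Rightarrow> ('a \<Rightarrow> real ^ 'd) \<Rightarrow> (real ^ 'd) set \<Rightarrow> real \<Rightarrow> (real ^ 'd) set" where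
  "Q_cone M X C p = {z. F_cone M X C z \<ge> p}"

definition lower_quantile :: "'a measure \<Rightarrow> ('a \<Rightarrow> real) \<Rightarrow> real \<Rightarrow> ereal" where
  "lower_quantile M Y p = (INF s \<in> {s. measure M {\<omega> \<in> space M. Y \<omega> \<le> s} \<ge> p}. ereal s)"

end

theory Submission
  imports Defs
begin

text \<open>Right continuity of distribution functions makes the infimum defining a univariate lower
  quantile attained whenever it is finite, so comparing a quantile with a real number amounts to
  comparing a probability with the level. Since a closed convex cone other than the whole space is
  missed by a point, separation provides a nonzero dual vector; hence the infimum over dual
  directions is a genuine one and the cone quantile is an intersection of directional ones.\<close>

lemma (in prob_space) lower_quantile_le_iff:
  assumes [measurable]: "Y \<in> borel_measurable M"
  shows "lower_quantile M Y p \<le> ereal s \<longleftrightarrow> p \<le> prob {\<omega> \<in> space M. Y \<omega> \<le> s}"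
proof
  assume le: "lower_quantile M Y p \<le> ereal s"
  interpret D: real_distribution "distr M borel Y"
    by simp
  have cdf_eq: "cdf (distr M borel Y) t = prob {\<omega> \<in> space M. Y \<omega> \<le> t}" for t
    by (auto simp: cdf_def measure_distr intro!: arg_cong[where f = prob])
  \<comment> \<open>The infimum is not yet known to be attained, so admissible points
    \<open>u\<close> are found only below each \<open>t > s\<close>; right continuity then lets
    \<open>t\<close> decrease to \<open>s\<close>.\<close>
  have ge: "p \<le> cdf (distr M borel Y) t" if "t > s" for t
  proof -
    have "lower_quantile M Y p < ereal t"
      using le that by (simp add: le_less_trans)
    then obtain u where "p \<le> prob {\<omega> \<in> space M. Y \<omega> \<le> u}" "u < t"
      by (auto simp: lower_quantile_def INF_less_iff)
    then show ?thesis
      using D.cdf_nondecreasing[of u t] by (simp add: cdf_eq)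
  qed
  have "(cdf (distr M borel Y) \<longlongrightarrow> cdf (distr M borel Y) s) (at_right s)"
    using D.cdf_is_right_cont[of s] by (simp add: continuous_within)
  then have "p \<le> cdf (distr M borel Y) s"
    by (rule tendsto_lowerbound) (auto simp: ge intro: eventually_at_rightI[of s "s + 1"])
  then show "p \<le> prob {\<omega> \<in> space M. Y \<omega> \<le> s}"
    by (simp add: cdf_eq)
next
  assume "p \<le> prob {\<omega> \<in> space M. Y \<omega> \<le> s}"
  then show "lower_quantile M Y p \<le> ereal s"
    unfolding lower_quantile_def by (intro INF_lower) simp
qed

text \<open>The normal of a hyperplane strictly separating \<open>C\<close> from a missed point
  works: were it negative somewhere on \<open>C\<close>, scaling would carry that point of
  \<open>C\<close> onto the hyperplane.\<close>

lemma dual_cone_nontrivial: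
  fixes C :: "(real ^ 'd) set"
  assumes "positive_cone C" "closed C" "convex C" "0 \<in> C" "C \<noteq> UNIV"
  shows "dual_cone C - {0} \<noteq> {}"
proof -
  obtain y where "y \<notin> C"
    using assms(5) by auto
  then obtain a b where ay: "a \<bullet> y < b" and aC: "\<And>x. x \<in> C \<Longrightarrow> a \<bullet> x > b"
    using separating_hyperplane_closed_point[OF assms(3,2)] by blast
  have b: "b < 0"
    using aC[OF assms(4)] by simp
  have "a \<bullet> x \<ge> 0" if "x \<in> C" for x
  proof (rule ccontr)
    assume neg: "\<not> a \<bullet> x \<ge> 0"
    \<comment> \<open>The factor is positive as a quotient of two negatives, and the scaled point
      has inner product exactly \<open>b\<close> with \<open>a\<close>.\<close>
    then have "(b / (a \<bullet> x)) *\<^sub>R x \<in> C"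
      using assms(1) that b by (simp add: positive_cone_def divide_neg_neg)
    from aC[OF this] neg show False
      by simp
  qed
  moreover have "a \<noteq> 0"
    using ay b by auto
  ultimately show ?thesis
    by (auto simp: dual_cone_def)
qed

text \<open>A real infimum is at least \<open>p\<close> iff all values are, provided the index set
  is nonempty and the values are bounded below; probabilities are bounded by 0.\<close>

lemma Q_cone_eq_Inter_Q_dir:
  assumes "dual_cone C - {0} \<noteq> {}"
  shows "Q_cone M X C p = (\<Inter>w\<in>dual_cone C - {0}. Q_dir M X w p)"
proof -
  have "bdd_below ((\<lambda>w. F_dir M X w z) ` (dual_cone C - {0}))" for z
    by (rule bdd_belowI2[where m = 0]) (simp add: F_dir_def)
  then show ?thesis
    using assms by (auto simp: Q_cone_def F_cone_def Q_dir_def le_cINF_iff)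
qed

theorem proposition4p1:
  fixes M :: "'a measure"
    and X :: "'a \<Rightarrow> real ^ 'd"
    and C :: "(real ^ 'd) set"
  assumes "prob_space M"
    and "X \<in> borel_measurable M"
    and "positive_cone C"
    and "closed C"
    and "convex C"
    and "0 \<in> C"
    and "C \<subset> UNIV"
  shows "(\<forall>w. w \<noteq> 0 \<longrightarrow> (\<forall>p\<in>{0..1}.
            Q_dir M X w p = {z. ereal (w \<bullet> z) \<ge> lower_quantile M (\<lambda>\<omega>. w \<bullet> X \<omega>) p}))
       \<and> (\<forall>p\<in>{0..1}.
            Q_cone M X C p =
              (\<Inter>w\<in>dual_cone C - {0}. {z. ereal (w \<bullet> z) \<ge> lower_quantile M (\<lambda>\<omega>. w \<bullet> X \<omega>) p}))
       \<and> (\<forall>w\<in>dual_cone C - {0}. \<forall>p\<in>{0..1}.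
            lower_quantile M (\<lambda>\<omega>. w \<bullet> X \<omega>) p \<le> (INF z\<in>Q_cone M X C p. ereal (w \<bullet> z)))"
proof -
  interpret prob_space M by fact
  have "(\<lambda>\<omega>. w \<bullet> X \<omega>) \<in> borel_measurable M" for w
    using assms(2) by measurable
  then have dir: "Q_dir M X w p = {z. ereal (w \<bullet> z) \<ge> lower_quantile M (\<lambda>\<omega>. w \<bullet> X \<omega>) p}" for w p
    by (simp add: Q_dir_def F_dir_def lower_quantile_le_iff)
  have "dual_cone C - {0} \<noteq> {}"
    using assms by (intro dual_cone_nontrivial) auto
  from Q_cone_eq_Inter_Q_dir[OF this, of M X] have cone: "Q_cone M X C p =
      (\<Inter>w\<in>dual_cone C - {0}. {z. ereal (w \<bullet> z) \<ge> lower_quantile M (\<lambda>\<omega>. w \<bullet> X \<omega>) p})" for p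
    by (simp only: dir)
  show ?thesis
    \<comment> \<open>For the last claim, \<open>cone\<close> makes the quantile a lower bound of
      \<open>w \<bullet> z\<close> over \<open>Q_cone M X C p\<close>; if that set is empty, the
      extended real infimum is infinite.\<close>
    by (intro conjI ballI allI impI dir cone INF_greatest) (auto simp: cone)
qed

end
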